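(* Let $a>2$, $m$, $s$, $k$ be positive integers, let $r=1+2ams$, and set \[ D:=m\left(m\left(ar^k-s\right)^2-2r^k\right). \] Define $d_1,\dots,d_{4k}$ by $d_{4j+1}=1$, $d_{4j+2}=ar^j-2$, $d_{4j+3}=1$, $d_{4j+4}=2amr^{k-1-j}-2$ for $0\le j\le k-1$ (so the sequence is $1,a-2,1,2amr^{k-1}-2,\ 1,ar-2,1,2amr^{k-2}-2,\dots,1,ar^{k-1}-2,1,2am-2$). Then $l(D)=8k+4$ and \[ \sqrt D=[m(ar^k-s)-1;\overline{d_1,\dots,d_{4k},\,1,\,ar^k-s-2,\,1,\,d_{4k},\dots,d_1,\,2m(ar^k-s)-2}]. \]
   Context: For a positive non-square integer $D$, $l(D)$ denotes the length of the fundamental (shortest) period of the regular continued fraction expansion of $\sqrt D$. $[a_0;\overline{b_1,\dots,b_m}]$ denotes the regular continued fraction whose partial quotients after $a_0$ are the block $b_1,\dots,b_m$ repeated infinitely often. *)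

theory Defs
  imports Complex_Main
begin

text \<open>Regular continued fraction algorithm. For irrational \<open>x\<close> no remainder has
  fractional part \<open>0\<close>, so the division is never by zero and the expansion is infinite.\<close>

primrec cf_remainder :: "real \<Rightarrow> nat \<Rightarrow> real" where
  "cf_remainder x 0 = x"
| "cf_remainder x (Suc n) = 1 / frac (cf_remainder x n)"

definition partial_quotient :: "real \<Rightarrow> nat \<Rightarrow> int" where
  "partial_quotient x n = \<lfloor>cf_remainder x n\<rfloor>"

text \<open>The preperiod \<open>N\<close> is left free; meaningful for positive non-square \<open>D\<close>.\<close>

definition sqrt_period_length :: "int \<Rightarrow> nat" where
  "sqrt_period_length D =
    (LEAST p. p > 0 \<and>
      (\<exists>N. \<forall>n\<ge>N. partial_quotient (sqrt (of_int D)) (n + p) = partial_quotient (sqrt (of_int D)) n))"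

text \<open>\<open>convergent_value c n\<close> is the finite continued fraction \<open>[c 0; c 1, \<dots>, c n]\<close>.\<close>

fun convergent_value :: "(nat \<Rightarrow> int) \<Rightarrow> nat \<Rightarrow> real" where
  "convergent_value c 0 = of_int (c 0)"
| "convergent_value c (Suc n) = of_int (c 0) + 1 / convergent_value (\<lambda>i. c (Suc i)) n"

definition equals_regular_cf :: "real \<Rightarrow> (nat \<Rightarrow> int) \<Rightarrow> bool" where
  "equals_regular_cf x c \<longleftrightarrow> (\<forall>n\<ge>1. c n \<ge> 1) \<and> convergent_value c \<longlonglongrightarrow> x"

definition periodic_quotients :: "int \<Rightarrow> int list \<Rightarrow> nat \<Rightarrow> int" where
  "periodic_quotients a0 bs n = (if n = 0 then a0 else bs ! ((n - 1) mod length bs))"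

end

theory Submission
  imports Defs
begin

text \<open>The expansion is the regularization of an expansion with minus signs,
  \<open>b - 1/z = [b - 1; 1, z - 1]\<close>, in which every partial quotient is at least \<open>3\<close>. Put
  \<open>T = m (a r\<^sup>k - s) + \<surd>D\<close>, so that \<open>T\<^sup>2 = 2 m (a r\<^sup>k - s) T - 2 m r\<^sup>k\<close>. The complete quotients of
  the minus expansion in the first half of the period are alternately \<open>T / (2 m r\<^sup>k\<^sup>-\<^sup>j)\<close> and
  \<open>(T + 2 m s) / r\<^sup>j\<^sup>+\<^sup>1\<close>; in the second half they are \<open>T / r\<^sup>j\<close> and \<open>(T + 2 m s) / (2 m r\<^sup>k\<^sup>-\<^sup>j)\<close>, with
  \<open>j\<close> decreasing. The period is minimal because its last entry is strictly larger than all others.\<close>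

section \<open>Regular continued fractions\<close>

text \<open>The bound is imposed from index 1 on only, so the leading quotient may be any integer.
  Since \<open>0 < 1 / x (Suc n) < 1\<close>, the floor algorithm started at \<open>x 0\<close> is
  forced to produce \<open>c\<close>.\<close>

locale complete_quotients =
  fixes c :: "nat \<Rightarrow> int" and x :: "nat \<Rightarrow> real"
  assumes step: "x n = of_int (c n) + 1 / x (Suc n)"
    and gt_1: "x (Suc n) > 1"
begin

lemma floor_eq: "\<lfloor>x n\<rfloor> = c n"
  using step[of n] gt_1[of n] by (intro floor_unique) auto

lemma cf_remainder_eq: "cf_remainder (x 0) n = x n"
proof (induction n)
  case (Suc n)
  have "frac (x n) = 1 / x (Suc n)"
    unfolding frac_def floor_eq using step[of n] by simp
  then show ?case using Suc by simp
qed simp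

lemma partial_quotient_eq: "partial_quotient (x 0) n = c n"
  by (simp add: partial_quotient_def cf_remainder_eq floor_eq)

lemma quotient_ge_1: "c (Suc n) \<ge> 1"
  using gt_1[of n] floor_eq[of "Suc n"] by linarith

lemma shift: "complete_quotients (\<lambda>i. c (Suc i)) (\<lambda>i. x (Suc i))"
  by unfold_locales (rule step, rule gt_1)

end

lemma convergent_value_ge_1:
  assumes "\<And>n. c n \<ge> 1"
  shows "convergent_value c n \<ge> 1"
  using assms
proof (induction n arbitrary: c)
  case 0
  then show ?case by simp
next
  case (Suc n)
  have "convergent_value (\<lambda>i. c (Suc i)) n \<ge> 1"
    by (rule Suc.IH) (rule Suc.prems)
  moreover have "real_of_int (c 0) \<ge> 1" using Suc.prems[of 0] by simp
  ultimately show ?case by (simp add: add_increasing2)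
qed

text \<open>The difference is \<open>(u - v) / ((b * u + 1) * (b * v + 1))\<close>, and both factors
  are at least 2. A single step \<open>u -> 1 / u\<close> has no uniform contraction factor near
  \<open>u = 1\<close>, hence two steps at once.\<close>

lemma two_step_contraction:
  fixes b u v :: real
  assumes "b \<ge> 1" "u \<ge> 1" "v \<ge> 1"
  shows "\<bar>1 / (b + 1 / u) - 1 / (b + 1 / v)\<bar> \<le> \<bar>u - v\<bar> / 4"
proof -
  have "b * u \<ge> 1" "b * v \<ge> 1" using assms mult_mono[of 1 b 1] by auto
  then have pos: "b * u + 1 \<ge> 2" "b * v + 1 \<ge> 2" by auto
  then have prod: "(b * u + 1) * (b * v + 1) \<ge> 4"
    using mult_mono[of 2 "b * u + 1" 2 "b * v + 1"] by auto
  have "1 / (b + 1 / u) = u / (b * u + 1)" "1 / (b + 1 / v) = v / (b * v + 1)"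
    using assms by (auto simp: field_simps)
  then have "1 / (b + 1 / u) - 1 / (b + 1 / v) = (u - v) / ((b * u + 1) * (b * v + 1))"
    using pos by (simp add: diff_frac_eq algebra_simps)
  then have "\<bar>1 / (b + 1 / u) - 1 / (b + 1 / v)\<bar> = \<bar>u - v\<bar> / ((b * u + 1) * (b * v + 1))"
    using prod by (simp add: abs_div)
  also have "\<dots> \<le> \<bar>u - v\<bar> / 4" using prod by (intro divide_left_mono) auto
  finally show ?thesis .
qed

text \<open>Induction in steps of two, applied to the tails of \<open>c\<close> and
  \<open>x\<close>: the contraction by 1/4 matches \<open>(1 / 2)^2\<close>. The leading constant 2
  is chosen for \<open>n = 1\<close>, where the error is bounded by 1.\<close>

lemma convergent_value_error:
  assumes "complete_quotients c x"
  shows "\<bar>convergent_value c n - x 0\<bar> \<le> 2 * (1 / 2) ^ n"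
  using assms
proof (induction n arbitrary: c x rule: induct_nat_012)
  case 0
  then interpret complete_quotients c x .
  show ?case using step[of 0] gt_1[of 0] by (simp add: divide_le_eq)
next
  case 1
  then interpret complete_quotients c x .
  have c1: "real_of_int (c 1) \<ge> 1" using quotient_ge_1[of 0] by simp
  have "0 \<le> 1 / x 1" "1 / x 1 \<le> 1" using gt_1[of 0] by auto
  moreover have "0 \<le> 1 / real_of_int (c 1)" "1 / real_of_int (c 1) \<le> 1" using c1 by auto
  ultimately have "\<bar>1 / real_of_int (c 1) - 1 / x 1\<bar> \<le> 1" by linarith
  then show ?case using step[of 0] by simp
next
  case (ge2 n)
  interpret complete_quotients c x by (rule ge2.prems)
  interpret s: complete_quotients "\<lambda>i. c (Suc i)" "\<lambda>i. x (Suc i)" by (rule shift)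
  let ?v = "convergent_value (\<lambda>i. c (Suc (Suc i))) n" and ?u = "x (Suc (Suc 0))"
  have IH: "\<bar>?v - ?u\<bar> \<le> 2 * (1 / 2) ^ n"
    by (rule ge2.IH(1)[OF s.shift])
  have v: "?v \<ge> 1"
    by (intro convergent_value_ge_1 quotient_ge_1)
  have u: "?u \<ge> 1" using gt_1[of "Suc 0"] by linarith
  have b: "real_of_int (c (Suc 0)) \<ge> 1" using quotient_ge_1[of 0] by simp
  have "x 0 = of_int (c 0) + 1 / (of_int (c (Suc 0)) + 1 / ?u)"
    by (simp only: step[of 0] step[of "Suc 0"])
  then have "\<bar>convergent_value c (Suc (Suc n)) - x 0\<bar> =
      \<bar>1 / (of_int (c (Suc 0)) + 1 / ?v) - 1 / (of_int (c (Suc 0)) + 1 / ?u)\<bar>"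
    by simp
  also have "\<dots> \<le> \<bar>?v - ?u\<bar> / 4" by (rule two_step_contraction[OF b v u])
  also have "\<dots> \<le> 2 * (1 / 2) ^ Suc (Suc n)" using IH by simp
  finally show ?case .
qed

lemma (in complete_quotients) equals_regular_cf: "equals_regular_cf (x 0) c"
proof -
  have "(\<lambda>n. (1 / 2 :: real) ^ n) \<longlonglongrightarrow> 0" by (rule LIMSEQ_realpow_zero) auto
  then have "(\<lambda>n. convergent_value c n - x 0) \<longlonglongrightarrow> 0"
  proof (rule tendsto_0_le, intro always_eventually allI)
    show "norm (convergent_value c n - x 0) \<le> norm ((1 / 2 :: real) ^ n) * 2" for n
      using convergent_value_error[OF complete_quotients_axioms, of n]
      by (simp add: power_one_over mult.commute)
  qed
  moreover have "c n \<ge> 1" if "n \<ge> 1" for n using that quotient_ge_1[of "n - 1"] by simp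
  ultimately show ?thesis
    unfolding equals_regular_cf_def using LIM_zero_iff by blast
qed

section \<open>Periodic expansions\<close>

text \<open>The value \<open>[b_1; ..., b_n, y]\<close> with a real last entry. Written as a fold,
  it turns concatenation of lists into composition of maps, so a long period can be evaluated block
  by block from its end.\<close>

definition cf_prepend :: "int list \<Rightarrow> real \<Rightarrow> real" where
  "cf_prepend bs y = foldr (\<lambda>b z. of_int b + 1 / z) bs y"

lemma cf_prepend_simps [simp]:
  "cf_prepend [] y = y"
  "cf_prepend (b # bs) y = of_int b + 1 / cf_prepend bs y"
  "cf_prepend (bs @ cs) y = cf_prepend bs (cf_prepend cs y)"
  by (simp_all add: cf_prepend_def)

lemma cf_prepend_gt_1:
  assumes "\<forall>b\<in>set bs. b \<ge> 1" "y > 1"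
  shows "cf_prepend bs y > 1"
  using assms
proof (induction bs)
  case (Cons b bs)
  then have "1 / cf_prepend bs y > 0" "real_of_int b \<ge> 1" by auto
  then show ?case unfolding cf_prepend_simps by linarith
qed simp

lemma complete_quotients_periodic:
  assumes "bs \<noteq> []" "\<forall>b\<in>set bs. b \<ge> 1" "y > 1" and fixpoint: "cf_prepend bs y = y"
  shows "complete_quotients (periodic_quotients a bs)
    (\<lambda>n. if n = 0 then of_int a + 1 / y else cf_prepend (drop ((n - 1) mod length bs) bs) y)"
proof
  fix n
  define i where "i = n mod length bs"
  have "set (drop i bs) \<subseteq> set bs" by (rule set_drop_subset)
  then show "(if Suc n = 0 then of_int a + 1 / y
      else cf_prepend (drop ((Suc n - 1) mod length bs) bs) y) > 1"
    unfolding i_def using assms by (auto intro!: cf_prepend_gt_1)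
next
  fix n
  show "(if n = 0 then of_int a + 1 / y else cf_prepend (drop ((n - 1) mod length bs) bs) y) =
    of_int (periodic_quotients a bs n) +
    1 / (if Suc n = 0 then of_int a + 1 / y
      else cf_prepend (drop ((Suc n - 1) mod length bs) bs) y)"
  proof (cases n)
    case 0
    then show ?thesis using fixpoint by (simp add: periodic_quotients_def)
  next
    case (Suc l)
    define i where "i = l mod length bs"
    have i: "i < length bs" using assms(1) by (simp add: i_def)
    \<comment> \<open>The only nontrivial case is the wrap-around at the last entry, where the left
      side is \<open>cf_prepend bs y\<close> and the right side is \<open>y\<close>.\<close>
    have "cf_prepend (drop (Suc l mod length bs) bs) y = cf_prepend (drop (Suc i) bs) y"
      using fixpoint i by (auto simp: mod_Suc i_def)
    moreover have "cf_prepend (drop i bs) y = of_int (bs ! i) + 1 / cf_prepend (drop (Suc i) bs) y"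
      using i by (simp flip: Cons_nth_drop_Suc)
    ultimately show ?thesis using Suc by (simp add: periodic_quotients_def i_def)
  qed
qed

text \<open>From index 1 on, \<open>M\<close> occurs exactly at the multiples of the period length.
  A shift that eventually preserves the sequence maps such an index to another one, hence is itself
  a multiple of that length.\<close>

lemma least_period_unique_max:
  fixes bs :: "int list" and a M :: int
  assumes less: "\<forall>b\<in>set bs. b < M"
  defines "q \<equiv> periodic_quotients a (bs @ [M])"
  shows "(LEAST p. p > 0 \<and> (\<exists>N. \<forall>n\<ge>N. q (n + p) = q n)) = Suc (length bs)"
proof (rule Least_equality)
  let ?L = "Suc (length bs)"
  have "q (n + ?L) = q n" if "n \<ge> 1" for n
  proof -
    have "n + ?L - 1 = (n - 1) + ?L" using that by simp
    then have "(n + ?L - 1) mod ?L = (n - 1) mod ?L" by (metis mod_add_self2)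
    then show ?thesis using that by (simp add: q_def periodic_quotients_def)
  qed
  then show "?L > 0 \<and> (\<exists>N. \<forall>n\<ge>N. q (n + ?L) = q n)" by blast
next
  let ?L = "Suc (length bs)"
  fix p assume "p > 0 \<and> (\<exists>N. \<forall>n\<ge>N. q (n + p) = q n)"
  then obtain N where p: "p > 0" and N: "\<And>n. n \<ge> N \<Longrightarrow> q (n + p) = q n" by blast
  define i where "i = (length bs + p) mod ?L"
  \<comment> \<open>The index \<open>N * ?L + ?L\<close> is chosen as a positive multiple of
    \<open>?L\<close> that is at least \<open>N\<close>.\<close>
  have "q (N * ?L + ?L + p) = q (N * ?L + ?L)" by (rule N) simp
  moreover have "q (N * ?L + ?L) = M"
  proof -
    have "(N * ?L + ?L - 1) mod ?L = (length bs + N * ?L) mod ?L" by (simp add: ac_simps)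
    also have "\<dots> = length bs" by (subst mod_mult_self1) simp
    finally show ?thesis by (simp add: q_def periodic_quotients_def nth_append)
  qed
  moreover have "q (N * ?L + ?L + p) = (bs @ [M]) ! i"
  proof -
    have "(N * ?L + ?L + p - 1) mod ?L = (length bs + p + N * ?L) mod ?L" by (simp add: ac_simps)
    also have "\<dots> = i" unfolding i_def by (rule mod_mult_self1)
    finally show ?thesis by (simp add: q_def periodic_quotients_def)
  qed
  ultimately have "\<not> i < length bs" using less by (auto simp: nth_append)
  moreover have "i < ?L" by (simp add: i_def)
  ultimately have "i = length bs" by simp
  \<comment> \<open>Now \<open>length bs + p\<close> and \<open>length bs\<close> agree modulo
    \<open>?L\<close>, so \<open>?L\<close> divides the positive number \<open>p\<close>.\<close>
  then show "?L \<le> p"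
    unfolding i_def using p by (metis One_nat_def add.commute add_cancel_right_left
      add_diff_cancel_left' dvd_imp_le lessI mod_eq_dvd_iff_nat mod_less le_add1)
qed

text \<open>The regularization identity lowered by 1. In this form input \<open>z - 1\<close> and
  output \<open>y - 1\<close> have the same shape, so consecutive minus steps compose
  directly.\<close>

lemma cf_prepend_minus_step:
  assumes "z > 1" "y = of_int c - 1 / z"
  shows "cf_prepend [c - 2, 1] (z - 1) = y - 1"
  using assms by (simp add: field_simps)

section \<open>The family\<close>

lemma base_bounds:
  fixes a m s r :: int
  assumes "a > 2" "m > 0" "s > 0" "r = 1 + 2 * a * m * s"
  shows "r \<ge> 7" "r > s"
proof -
  have "a * m \<ge> 3 * 1" using assms by (intro mult_mono) auto
  then have "a * m * s \<ge> 3 * s" using assms by (intro mult_right_mono) auto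
  moreover have "r = 1 + 2 * (a * m * s)" using assms by simp
  ultimately show "r \<ge> 7" "r > s" using assms(3) by linarith+
qed

text \<open>As \<open>a >= 3\<close> and \<open>s < r <= r ^ k\<close>, subtracting \<open>s\<close>
  costs less than one copy of \<open>r ^ k\<close>. Stated outside the locale because its assumption
  \<open>T_gt\<close> is itself derived from these bounds.\<close>

lemma power_bounds:
  fixes a m s r :: int
  assumes "a > 2" "m > 0" "s > 0" "k > 0" "r = 1 + 2 * a * m * s"
  shows "r ^ k \<ge> 7" "r ^ k < a * r ^ k - s"
proof -
  note r = base_bounds[OF assms(1-3,5)]
  have "r ^ 1 \<le> r ^ k" using assms(4) r by (intro power_increasing) auto
  then have "r ^ k \<ge> r" by simp
  moreover have "3 * r ^ k \<le> a * r ^ k" using assms(1) r by (intro mult_right_mono) auto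
  ultimately show "r ^ k \<ge> 7" "r ^ k < a * r ^ k - s" using r assms(3) by linarith+
qed

text \<open>\<open>T_root\<close> is the quadratic with roots \<open>m * A + sqrt D\<close> and
  \<open>m * A - sqrt D\<close>, where \<open>A = a * r ^ k - s\<close>. The product of the roots is
  \<open>2 * m * r ^ k\<close>, so \<open>T_gt\<close> selects the root whose conjugate is less than
  1.\<close>

locale family =
  fixes a m s r :: int and k :: nat and T :: real
  assumes a: "a > 2" and m: "m > 0" and s: "s > 0" and k: "k > 0"
    and r: "r = 1 + 2 * a * m * s"
    and T_gt: "T > 2 * of_int m * of_int r ^ k"
    and T_root: "T\<^sup>2 = 2 * of_int m * (of_int a * of_int r ^ k - of_int s) * T
      - 2 * of_int m * of_int r ^ k"
begin

definition block :: "nat \<Rightarrow> int list" where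
  "block j = [1, a * r ^ j - 2, 1, 2 * a * m * r ^ (k - 1 - j) - 2]"

lemmas r_ge = base_bounds[OF a m s r]

text \<open>These powers are the denominators of the complete quotients of the minus expansion; that
  they stay below \<open>T\<close> supplies the condition \<open>z > 1\<close> of each minus
  step.\<close>

lemma power_r_bounds:
  assumes "j \<le> k"
  shows "1 \<le> real_of_int r ^ j" "real_of_int r ^ j < T" "2 * of_int m * of_int r ^ j < T"
proof -
  have r1: "real_of_int r \<ge> 1" using r_ge by simp
  show p: "1 \<le> real_of_int r ^ j" using r1 by (rule one_le_power)
  have "real_of_int r ^ j \<le> real_of_int r ^ k" using assms r1 by (rule power_increasing)
  then have "2 * of_int m * of_int r ^ j \<le> 2 * of_int m * real_of_int r ^ k" using m by simp
  then show *: "2 * of_int m * of_int r ^ j < T" using T_gt by linarith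
  have "1 * real_of_int r ^ j \<le> 2 * of_int m * of_int r ^ j"
    using m p by (intro mult_right_mono) auto
  then show "real_of_int r ^ j < T" using * by simp
qed

lemma T_gt_0: "T > 0"
  using power_r_bounds[of 0] by simp

text \<open>With \<open>U = T + 2 * m * s\<close>, division by \<open>T\<close> gives
  \<open>U = 2 * m * r ^ k * (a - 1 / T)\<close>, a minus step from \<open>T\<close> to
  \<open>U\<close> up to scaling.\<close>

lemma T_mult:
  "T * (T + 2 * of_int m * of_int s) = 2 * of_int m * of_int r ^ k * (of_int a * T - 1)"
  using T_root by (simp add: power2_eq_square algebra_simps)

lemma r_real: "real_of_int r = 1 + 2 * of_int a * of_int m * of_int s"
  using r by simp

text \<open>The choice of \<open>r\<close> makes \<open>a * T - 1 = a * U - r\<close>. Division by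
  \<open>U\<close> now gives the step back from \<open>U\<close> to \<open>T\<close>, and its factor
  \<open>r\<close> changes the scaling of \<open>T\<close> by one power of \<open>r\<close> per
  block.\<close>

lemma T_mult':
  "T * (T + 2 * of_int m * of_int s) = 2 * of_int m * of_int r ^ k *
    (of_int a * (T + 2 * of_int m * of_int s) - of_int r)"
  unfolding T_mult by (simp add: r_real algebra_simps)

lemma power_split: "j < k \<Longrightarrow> real_of_int r ^ k = of_int r * of_int r ^ j * of_int r ^ (k - 1 - j)"
  by (simp flip: power_Suc power_add)

text \<open>Each block is two minus steps, \<open>T\<close> to \<open>U\<close> and back. A minus
  step contributes \<open>[c - 2, 1]\<close>, which fits the reversed block exactly; the forward
  block begins with its 1, so there the pattern is shifted and a \<open>cf_prepend [1]\<close> is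
  carried along on both sides.\<close>

lemma block_step:
  assumes "j < k"
  shows "cf_prepend (block j) (cf_prepend [1] (T / (2 * of_int m * of_int r ^ (k - Suc j)) - 1)) =
    cf_prepend [1] (T / (2 * of_int m * of_int r ^ (k - j)) - 1)"
    and "cf_prepend (rev (block j)) (T / of_int r ^ j - 1) = T / of_int r ^ Suc j - 1"
proof -
  define p where "p = real_of_int r ^ j"
  define q where "q = real_of_int r ^ (k - 1 - j)"
  define R where "R = real_of_int r"
  define U where "U = T + 2 * of_int m * of_int s"
  define A where "A = real_of_int a"
  define M where "M = real_of_int m"
  have powers: "real_of_int r ^ (k - Suc j) = q" "real_of_int r ^ (k - j) = R * q"
    "real_of_int r ^ Suc j = R * p"
    using assms by (auto simp: q_def p_def R_def Suc_diff_Suc simp flip: power_Suc)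
  have pos: "p > 0" "q > 0" "R > 0" "M > 0" "T > 0"
    using r_ge m T_gt_0 by (auto simp: p_def q_def R_def M_def)
  have "2 * real_of_int m * of_int s > 0" using m s by simp
  then have U: "U > T" "U > 0" using T_gt_0 by (auto simp: U_def)
  \<comment> \<open>With \<open>r ^ k\<close> split as \<open>R * p * q\<close>, the four minus
    steps below differ only in how \<open>2 * M * R * p * q\<close> is shared between the two
    sides.\<close>
  have rel: "T * U = 2 * M * (R * p * q) * (A * T - 1)" "T * U = 2 * M * (R * p * q) * (A * U - R)"
    using T_mult T_mult' power_split[OF assms]
    by (simp_all add: U_def p_def q_def R_def M_def A_def)
  have bounds: "R * p < T" "p < T" "2 * M * q < T" "2 * M * (R * q) < T"
    using power_r_bounds[of "Suc j"] power_r_bounds[of j] power_r_bounds[of "k - Suc j"]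
      power_r_bounds[of "k - j"] assms
    unfolding powers M_def[symmetric] p_def[symmetric] by auto
  have c: "real_of_int (a * r ^ j) = A * p" "real_of_int (2 * a * m * r ^ (k - 1 - j)) = 2 * A * M * q"
    by (simp_all add: A_def M_def p_def q_def)

  have 1: "cf_prepend [2 * a * m * r ^ (k - 1 - j) - 2, 1] (T / (2 * M * q) - 1) = U / (R * p) - 1"
  proof (rule cf_prepend_minus_step)
    show "U / (R * p) = of_int (2 * a * m * r ^ (k - 1 - j)) - 1 / (T / (2 * M * q))"
      unfolding c using pos rel(1) by (simp add: field_simps)
  qed (use bounds pos in simp)
  have 2: "cf_prepend [a * r ^ j - 2, 1] (U / (R * p) - 1) = T / (2 * M * (R * q)) - 1"
  proof (rule cf_prepend_minus_step)
    show "T / (2 * M * (R * q)) = of_int (a * r ^ j) - 1 / (U / (R * p))"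
      unfolding c using pos U rel(2) by (simp add: field_simps)
  qed (use bounds pos U in simp)
  show "cf_prepend (block j) (cf_prepend [1] (T / (2 * of_int m * of_int r ^ (k - Suc j)) - 1)) =
    cf_prepend [1] (T / (2 * of_int m * of_int r ^ (k - j)) - 1)"
    unfolding powers M_def[symmetric] 2[symmetric] 1[symmetric] by (simp add: block_def)

  have 3: "cf_prepend [a * r ^ j - 2, 1] (T / p - 1) = U / (2 * M * (R * q)) - 1"
  proof (rule cf_prepend_minus_step)
    show "U / (2 * M * (R * q)) = of_int (a * r ^ j) - 1 / (T / p)"
      unfolding c using pos rel(1) by (simp add: field_simps)
  qed (use bounds pos in simp)
  have 4: "cf_prepend [2 * a * m * r ^ (k - 1 - j) - 2, 1] (U / (2 * M * (R * q)) - 1) = T / (R * p) - 1"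
  proof (rule cf_prepend_minus_step)
    show "T / (R * p) = of_int (2 * a * m * r ^ (k - 1 - j)) - 1 / (U / (2 * M * (R * q)))"
      unfolding c using pos U rel(2) by (simp add: field_simps)
  qed (use bounds pos U in simp)
  show "cf_prepend (rev (block j)) (T / of_int r ^ j - 1) = T / of_int r ^ Suc j - 1"
    unfolding powers p_def[symmetric] 4[symmetric] 3[symmetric] by (simp add: block_def)
qed

section \<open>Chaining the blocks\<close>

definition blocks :: "nat \<Rightarrow> int list" where
  "blocks n = concat (map block [0..<n])"

lemma blocks_Suc: "blocks (Suc n) = blocks n @ block n"
  by (simp add: blocks_def)

lemma cf_prepend_blocks:
  assumes "n \<le> k"
  shows "cf_prepend (blocks n) (cf_prepend [1] (T / (2 * of_int m * of_int r ^ (k - n)) - 1)) =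
    cf_prepend [1] (T / (2 * of_int m * of_int r ^ k) - 1)"
  using assms
proof (induction n)
  case 0
  then show ?case by (simp add: blocks_def)
next
  case (Suc n)
  then show ?case using block_step(1)[of n] unfolding blocks_Suc cf_prepend_simps(3) by simp
qed

lemma cf_prepend_rev_blocks:
  assumes "n \<le> k"
  shows "cf_prepend (rev (blocks n)) (T - 1) = T / of_int r ^ n - 1"
  using assms
proof (induction n)
  case 0
  then show ?case by (simp add: blocks_def)
next
  case (Suc n)
  then show ?case
    using block_step(2)[of n] unfolding blocks_Suc rev_append cf_prepend_simps(3) by simp
qed

lemma length_blocks: "length (blocks n) = 4 * n"
  by (induction n) (simp_all add: blocks_Suc, simp_all add: blocks_def block_def)

section \<open>The full period and the size of its entries\<close>

definition A :: int where
  "A = a * r ^ k - s"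

lemma A_gt: "A > r ^ k" and A_gt': "A > a * r ^ (k - 1)"
proof -
  show "A > r ^ k" unfolding A_def by (rule power_bounds[OF a m s k r])
  have pk: "r ^ (k - 1) \<ge> 1" using r_ge by (intro one_le_power) auto
  then have "a * r ^ (k - 1) \<ge> 3 * 1" using a by (intro mult_mono) auto
  then have *: "a * r ^ (k - 1) * (r - 1) \<ge> 3 * (r - 1)" using r_ge by (intro mult_right_mono) auto
  \<comment> \<open>The first summand is at least \<open>3 * (r - 1)\<close>, which exceeds
    \<open>s\<close>.\<close>
  have "a * r ^ k = a * r ^ (k - 1) * (r - 1) + a * r ^ (k - 1)"
    using k by (cases k) (auto simp: algebra_simps)
  then show "A > a * r ^ (k - 1)" using * r_ge s by (simp add: A_def)
qed

text \<open>The last entry \<open>2 * m * A - 2\<close> is left out, since minimality compares all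
  other entries with it.\<close>

definition period :: "int list" where
  "period = blocks k @ [1, A - 2, 1] @ rev (blocks k)"

text \<open>Evaluated from the end, the value passes through \<open>T - 1\<close>,
  \<open>T / r ^ k - 1\<close> and \<open>T / (2 * m) - 1\<close>, and the forward blocks then lead
  back to the start.\<close>

lemma period_fixpoint:
  "cf_prepend (period @ [2 * m * A - 2]) (1 / (T - 2 * of_int m * of_int A + 1)) =
    1 / (T - 2 * of_int m * of_int A + 1)"
proof -
  let ?M = "real_of_int m" and ?A = "real_of_int A" and ?R = "real_of_int r ^ k"
  have pos: "?R > 0" "?M > 0" "T > 0" using r_ge m T_gt_0 by auto
  have b: "?R < T" "2 * ?M * ?R < T" using power_r_bounds[of k] by auto
  have sq: "T * T = 2 * ?M * (?A * T - ?R)"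
    using T_root by (simp add: A_def power2_eq_square algebra_simps)
  have start: "cf_prepend [2 * m * A - 2] (1 / (T - 2 * ?M * ?A + 1)) = T - 1" by simp
  have second: "cf_prepend (rev (blocks k)) (T - 1) = T / ?R - 1" by (rule cf_prepend_rev_blocks) simp
  have mid: "cf_prepend [A - 2, 1] (T / ?R - 1) = T / (2 * ?M) - 1"
  proof (rule cf_prepend_minus_step)
    \<comment> \<open>This is the quadratic equation divided by \<open>2 * m * T\<close>.\<close>
    show "T / (2 * ?M) = of_int A - 1 / (T / ?R)" using pos sq by (simp add: field_simps)
  qed (use b pos in simp)
  have front: "cf_prepend (blocks k) (cf_prepend [1] (T / (2 * ?M) - 1)) =
    cf_prepend [1] (T / (2 * ?M * ?R) - 1)"
    using cf_prepend_blocks[of k] by simp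
  have Tw: "T * (T - 2 * ?M * ?A) = - (2 * ?M * ?R)" using sq by (simp add: algebra_simps)
  \<comment> \<open>The conjugate root, equal to \<open>2 * m * A - T\<close>; the loop closes
    because \<open>[1; 1 / d - 1] = 1 / (1 - d)\<close>.\<close>
  define d where "d = 2 * ?M * ?R / T"
  have "T - 2 * ?M * ?A + 1 = 1 - d"
    using Tw pos by (simp add: d_def field_simps)
  moreover have "T / (2 * ?M * ?R) = 1 / d" by (simp add: d_def)
  moreover have "0 < d" "d < 1" using pos b by (auto simp: d_def)
  then have "1 + 1 / (1 / d - 1) = 1 / (1 - d)" by (simp add: field_simps)
  ultimately have x: "cf_prepend [1] (T / (2 * ?M * ?R) - 1) = 1 / (T - 2 * ?M * ?A + 1)" by simp
  have "[1, A - 2, 1] = [1] @ [A - 2, 1]" by simp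
  then show ?thesis unfolding period_def
    by (simp only: cf_prepend_simps(3) start second mid front x append_assoc)
qed

lemma set_blocks:
  assumes "b \<in> set (blocks k)"
  shows "b = 1 \<or> (\<exists>j<k. b = a * r ^ j - 2 \<or> b = 2 * a * m * r ^ j - 2)"
proof -
  obtain j where "j < k" "b \<in> set (block j)" using assms by (auto simp: blocks_def)
  moreover have "k - 1 - j < k" using k by simp
  ultimately show ?thesis unfolding block_def by (metis list.distinct(1) set_ConsD list.set_cases)
qed

lemma period_bounds:
  assumes "b \<in> set period"
  shows "1 \<le> b \<and> b < 2 * m * A - 2"
proof -
  have A7: "A > 7" using A_gt power_bounds(1)[OF a m s k r] by linarith
  have mA: "1 * A \<le> m * A" using m A7 by (intro mult_right_mono) auto
  consider "b = 1" | "b = A - 2" | j where "j < k" "b = a * r ^ j - 2 \<or> b = 2 * a * m * r ^ j - 2"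
    using assms set_blocks by (auto simp: period_def)
  then show ?thesis
  proof cases
    case 3
    \<comment> \<open>The entries are \<open>?e - 2\<close> and \<open>2 * m * ?e - 2\<close>, so
      \<open>3 <= ?e < A\<close> gives both bounds.\<close>
    let ?e = "a * r ^ j"
    have "r ^ j \<ge> 1" using r_ge by (intro one_le_power) auto
    then have e3: "?e \<ge> 3 * 1" using a by (intro mult_mono) auto
    have "r ^ j \<le> r ^ (k - 1)" using 3 r_ge by (intro power_increasing) auto
    then have "?e \<le> a * r ^ (k - 1)" using a by simp
    then have eA: "?e < A" using A_gt' by simp
    have "m * ?e < m * A" using eA m by simp
    moreover have "m * ?e \<ge> 1 * ?e" using m e3 by (intro mult_right_mono) auto
    moreover have "2 * a * m * r ^ j = 2 * (m * ?e)" by simp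
    ultimately show ?thesis using 3(2) e3 by linarith
  qed (use A7 mA in linarith)+
qed

end

section \<open>Locating \<open>sqrt D\<close> and assembling the expansion\<close>

theorem theorem5:
  fixes a m s r D :: int and k :: nat and ds :: "int list"
  assumes "a > 2" and "m > 0" and "s > 0" and "k > 0"
    and "r = 1 + 2 * a * m * s"
    and "D = m * (m * (a * r ^ k - s)\<^sup>2 - 2 * r ^ k)"
    and "ds = concat (map (\<lambda>j. [1, a * r ^ j - 2, 1, 2 * a * m * r ^ (k - 1 - j) - 2]) [0..<k])"
  shows "D > 0 \<and> (\<nexists>q::int. D = q\<^sup>2) \<and>
    sqrt_period_length D = 8 * k + 4 \<and>
    equals_regular_cf (sqrt (of_int D))
      (periodic_quotients (m * (a * r ^ k - s) - 1)
        (ds @ [1, a * r ^ k - s - 2, 1] @ rev ds @ [2 * m * (a * r ^ k - s) - 2]))"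
proof -
  define A where "A = a * r ^ k - s"
  define w where "w = sqrt (of_int D)"
  have A: "A > r ^ k" "r ^ k \<ge> 7" using power_bounds[OF assms(1-5)] by (auto simp: A_def)
  have D: "D = m * (m * A\<^sup>2 - 2 * r ^ k)" using assms by (simp add: A_def)
  have mA: "m * A \<ge> m * r ^ k + m" using A mult_left_mono[of "r ^ k + 1" A m] assms(2)
    by (simp add: algebra_simps)
  have mR: "m * r ^ k \<ge> 1 * 7" using A assms(2) by (intro mult_mono) auto
  \<comment> \<open>\<open>D\<close> lies strictly between consecutive squares, which excludes
    squares and identifies \<open>m * A - 1\<close> as the integer part of the root.\<close>
  have D_lower: "(m * A - 1)\<^sup>2 < D"
    using mA assms(2) by (simp add: D power2_eq_square algebra_simps)
  have D_upper: "D < (m * A)\<^sup>2"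
    using mR by (simp add: D power2_eq_square algebra_simps)
  have D_pos: "D > 0" using D_lower by (meson le_less_trans zero_le_power2)
  have nonsquare: "\<nexists>q::int. D = q\<^sup>2"
  proof
    assume "\<exists>q::int. D = q\<^sup>2"
    then obtain q where "D = q\<^sup>2" by blast
    then have "(m * A - 1)\<^sup>2 < \<bar>q\<bar>\<^sup>2" "\<bar>q\<bar>\<^sup>2 < (m * A)\<^sup>2" using D_lower D_upper by auto
    moreover have "m * A \<ge> 0" using mA mR assms(2) by linarith
    ultimately have "m * A - 1 < \<bar>q\<bar>" "\<bar>q\<bar> < m * A"
      by (meson power2_less_imp_less abs_ge_zero)+
    then show False by simp
  qed
  have w_lower: "of_int m * of_int A - 1 < w"
  proof -
    have "real_of_int ((m * A - 1)\<^sup>2) < of_int D" using D_lower by (simp only: of_int_less_iff)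
    then show ?thesis unfolding w_def by (intro real_less_rsqrt) simp
  qed
  have w_upper: "w < of_int m * of_int A"
  proof -
    have "real_of_int D < of_int ((m * A)\<^sup>2)" using D_upper by (simp only: of_int_less_iff)
    moreover have "real_of_int m * of_int A > 0"
      using mA mR assms(2) by (simp flip: of_int_mult)
    ultimately show ?thesis unfolding w_def by (intro real_less_lsqrt) (use D_pos in auto)
  qed
  have w_sq: "w\<^sup>2 = of_int m * (of_int m * (of_int A)\<^sup>2 - 2 * of_int r ^ k)"
  proof -
    have "w\<^sup>2 = of_int D" using D_pos by (simp add: w_def)
    then show ?thesis by (simp add: D)
  qed
  interpret F: family a m s r k "of_int m * of_int A + w"
  proof
    have "2 * m * r ^ k \<le> 2 * (m * A) - 1" using mA assms(2) by linarith
    then have "real_of_int (2 * m * r ^ k) \<le> of_int (2 * (m * A) - 1)"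
      by (simp only: of_int_le_iff)
    then show "2 * of_int m * of_int r ^ k < of_int m * of_int A + w" using w_lower by simp
    have "(of_int m * of_int A + w)\<^sup>2 =
      2 * of_int m * of_int A * (of_int m * of_int A + w) - 2 * of_int m * of_int r ^ k"
      using w_sq by (simp add: power2_eq_square algebra_simps)
    then show "(of_int m * of_int A + w)\<^sup>2 = 2 * of_int m *
      (of_int a * of_int r ^ k - of_int s) * (of_int m * of_int A + w) - 2 * of_int m * of_int r ^ k"
      by (simp add: A_def)
  qed (use assms in auto)
  have FA: "F.A = A" by (simp add: F.A_def A_def)
  have ds: "ds = F.blocks k" unfolding assms(7) F.blocks_def F.block_def by simp
  define bs where "bs = F.period @ [2 * m * A - 2]"
  have bs: "ds @ [1, a * r ^ k - s - 2, 1] @ rev ds @ [2 * m * (a * r ^ k - s) - 2] = bs"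
    by (simp add: bs_def F.period_def ds FA A_def)
  \<comment> \<open>The complete quotient left after splitting off \<open>m * A - 1\<close> from
    \<open>w\<close>; it is the fixpoint above because
    \<open>T - 2 * m * A = w - m * A\<close>.\<close>
  define y where "y = 1 / (w - of_int m * of_int A + 1)"
  have fixpoint: "cf_prepend bs y = y"
    using F.period_fixpoint by (simp add: bs_def y_def FA algebra_simps)
  have y: "y > 1" using w_lower w_upper by (simp add: y_def)
  have ge1: "\<forall>b\<in>set bs. b \<ge> 1"
    using F.period_bounds mA mR assms(2) by (auto simp: bs_def FA)
  define q where "q = periodic_quotients (m * A - 1) bs"
  define x where "x = (\<lambda>n. if n = 0 then of_int (m * A - 1) + 1 / y
    else cf_prepend (drop ((n - 1) mod length bs) bs) y)"
  interpret complete_quotients q x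
    unfolding q_def x_def by (rule complete_quotients_periodic) (use fixpoint y ge1 bs_def in auto)
  have x0: "x 0 = w" by (simp add: x_def y_def)
  have "sqrt_period_length D = Suc (length F.period)"
    unfolding sqrt_period_length_def w_def[symmetric] x0[symmetric] partial_quotient_eq q_def bs_def
    by (rule least_period_unique_max) (use F.period_bounds FA in auto)
  also have "\<dots> = 8 * k + 4" by (simp add: F.period_def F.length_blocks)
  finally have "sqrt_period_length D = 8 * k + 4" .
  moreover have "equals_regular_cf w q" using equals_regular_cf by (simp add: x0)
  ultimately show ?thesis
    using D_pos nonsquare unfolding bs by (simp add: w_def q_def A_def)
qed

end
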